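(* Let $A, B$ be integers with $1 \leq A \leq B$. Let $\mathcal{P}$ be the set of Dyck paths whose up-run lengths avoid $\{Ar + B \mid r \geq 0\}$. Then $\mathcal{P}$ satisfies the grammatical equation $$\mathcal{P} \cup U^B (D\mathcal{P})^B = \bigcup_{0 \leq k < A} U^k (D\mathcal{P})^k \ \cup\ U^A (\mathcal{P}D)^A \mathcal{P},$$ and therefore $$P(z) + z^B P(z)^B = \sum_{0 \leq k < A} z^k P(z)^k + z^A P(z)^{A+1},$$ where $P(z)$ is the weight-enumerator of $\mathcal{P}$.
   Context: A Dyck path is a finite (possibly empty) word in the letters $U$ (standing for $+1$) and $D$ (standing for $-1$) whose partial sums are all nonnegative and whose total sum is $0$. A Dyck path of length $2n$ is said to have semilength $n$. An up-run of length $\ell$ is a block of $\ell$ consecutive $U$'s that is neither preceded nor followed by a $U$ (a maximal block of $U$'s). The up-run lengths of a path avoid a set $S$ if the path has no up-run whose length lies in $S$. A grammatical equation is an equality of sets of words over $\{U,D\}$, combined by concatenation: for languages $L, L'$, $LL'$ is the set of words $ww'$ with $w\in L$, $w'\in L'$; $L^k$ is the $k$-fold concatenation, $L^0=\{\epsilon\}$ with $\epsilon$ the empty word; $U$ and $D$ denote the one-letter languages. The weight-enumerator of $\mathcal{P}$ is the formal power series $P(z) = \sum_{n \geq 0} p_n z^n$, where $p_n$ is the number of paths of semilength $n$ in $\mathcal{P}$. *)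

theory Defs
  imports "HOL-Computational_Algebra.Formal_Power_Series"
begin

datatype letter = U | D

fun step :: "letter \<Rightarrow> int" where
  "step U = 1"
| "step D = -1"

definition dyck_path :: "letter list \<Rightarrow> bool" where
  "dyck_path w \<longleftrightarrow>
     (\<forall>i \<le> length w. 0 \<le> sum_list (map step (take i w))) \<and> sum_list (map step w) = 0"

definition has_up_run :: "letter list \<Rightarrow> nat \<Rightarrow> bool" where
  "has_up_run w l \<longleftrightarrow> 0 < l \<and>
     (\<exists>xs ys. w = xs @ replicate l U @ ys \<and>
        (xs = [] \<or> last xs \<noteq> U) \<and> (ys = [] \<or> hd ys \<noteq> U))"

definition up_runs_avoid :: "letter list \<Rightarrow> nat set \<Rightarrow> bool" where
  "up_runs_avoid w S \<longleftrightarrow> \<not> (\<exists>l \<in> S. has_up_run w l)"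

definition conc :: "letter list set \<Rightarrow> letter list set \<Rightarrow> letter list set"
    (infixr \<open>\<odot>\<close> 75) where
  "L \<odot> L' = {w @ w' | w w'. w \<in> L \<and> w' \<in> L'}"

primrec lang_pow :: "letter list set \<Rightarrow> nat \<Rightarrow> letter list set"
    (infixr \<open>\<up>\<close> 80) where
  "L \<up> 0 = {[]}"
| "L \<up> Suc k = L \<odot> L \<up> k"

(* The cardinality is that of a finite set, as there are finitely many words of each length. *)
definition weight_enumerator :: "letter list set \<Rightarrow> int fps" where
  "weight_enumerator L = Abs_fps (\<lambda>n. int (card {w \<in> L. length w = 2 * n}))"

end

theory Submission
  imports Defs
begin

text \<open>
  Splitting a Dyck path after its initial up-run, of length \<open>k\<close> say, at the first descent below each
  of the heights \<open>k, \<dots>, 1\<close> shows that \<open>\<P>\<close> is the disjoint union of the unambiguous products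
  \<open>U\<^sup>k (D\<P>)\<^sup>k\<close> over the allowed lengths \<open>k\<close>. As \<open>U\<^sup>A (\<P>D)\<^sup>A \<P> = U\<^sup>A \<P> (D\<P>)\<^sup>A\<close>, expanding
  the factor \<open>\<P>\<close> shifts the allowed lengths by \<open>A\<close>. Shifting the forbidden set \<open>{Ar + B}\<close> by \<open>A\<close>
  removes only \<open>B\<close> from it, so the shifted allowed lengths together with all \<open>k < A\<close> are the
  allowed lengths together with \<open>B\<close>.
\<close>

section \<open>Languages\<close>

lemma concE:
  assumes "w \<in> L \<odot> L'"
  obtains u v where "w = u @ v" "u \<in> L" "v \<in> L'"
  using assms by (auto simp: conc_def)

lemma conc_image: "L \<odot> L' = (\<lambda>(u, v). u @ v) ` (L \<times> L')"
  by (auto simp: conc_def)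

lemma conc_assoc: "(L \<odot> L') \<odot> L'' = L \<odot> L' \<odot> L''"
  unfolding conc_def by (auto; metis append.assoc)

lemma conc_Nil_left [simp]: "{[]} \<odot> L = L"
  and conc_Nil_right [simp]: "L \<odot> {[]} = L"
  by (auto simp: conc_def)

lemma conc_UN_left: "(\<Union>i\<in>I. L i) \<odot> L' = (\<Union>i\<in>I. L i \<odot> L')"
  and conc_UN_right: "L' \<odot> (\<Union>i\<in>I. L i) = (\<Union>i\<in>I. L' \<odot> L i)"
  by (auto simp: conc_def)

lemma lang_pow_add: "L \<up> (m + n) = L \<up> m \<odot> L \<up> n"
  by (induction m) (auto simp: conc_assoc)

lemma lang_pow_singleton: "{[a]} \<up> n = {replicate n a}"
  by (induction n) (auto simp: conc_def)

text \<open>Both sides are the alternating product that starts and ends with \<open>L\<close>. It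
  serves to turn \<open>(P \<odot> {[D]}) \<up> A \<odot> P\<close> into
  \<open>P \<odot> ({[D]} \<odot> P) \<up> A\<close>.\<close>

lemma lang_pow_rotate: "(L \<odot> L') \<up> n \<odot> L = L \<odot> (L' \<odot> L) \<up> n"
  by (induction n) (simp_all add: conc_assoc)

section \<open>Walks\<close>

text \<open>Paths from height \<open>h\<close> down to 0 that never go negative. Using a natural
  number for the current height replaces the condition on all prefixes by structural
  recursion.\<close>

fun walk :: "nat \<Rightarrow> letter list \<Rightarrow> bool" where
  "walk h [] \<longleftrightarrow> h = 0"
| "walk h (U # w) \<longleftrightarrow> walk (Suc h) w"
| "walk 0 (D # w) \<longleftrightarrow> False"
| "walk (Suc h) (D # w) \<longleftrightarrow> walk h w"

lemma walk_iff_partial_sums: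
  "walk h w \<longleftrightarrow> (\<forall>i \<le> length w. 0 \<le> int h + sum_list (map step (take i w))) \<and>
     int h + sum_list (map step w) = 0"
proof (induction h w rule: walk.induct)
  case (2 h w)
  have "(\<forall>i \<le> length (U # w). 0 \<le> int h + sum_list (map step (take i (U # w)))) \<longleftrightarrow>
      (\<forall>i \<le> length w. 0 \<le> int (Suc h) + sum_list (map step (take i w)))"
    \<comment> \<open>\<open>All_less_Suc2\<close> splits off the index 0, whose condition only says
      that the starting height is nonnegative.\<close>
    by (auto simp: All_less_Suc2 simp flip: less_Suc_eq_le)
  with 2 show ?case by (simp add: algebra_simps)
next
  case (3 w)
  have "\<not> 0 \<le> int 0 + sum_list (map step (take 1 (D # w)))" by simp
  then show ?case by (metis One_nat_def Suc_le_mono le0 length_Cons walk.simps(3))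
next
  case (4 h w)
  have "(\<forall>i \<le> length (D # w). 0 \<le> int (Suc h) + sum_list (map step (take i (D # w)))) \<longleftrightarrow>
      (\<forall>i \<le> length w. 0 \<le> int h + sum_list (map step (take i w)))"
    by (auto simp: All_less_Suc2 simp flip: less_Suc_eq_le)
  with 4 show ?case by (simp add: algebra_simps)
qed simp

lemma dyck_path_iff_walk: "dyck_path w \<longleftrightarrow> walk 0 w"
  unfolding dyck_path_def walk_iff_partial_sums by simp

text \<open>Lifted by \<open>k\<close>, the walk \<open>u\<close> stays at height at least
  \<open>k\<close> and ends there, where \<open>v\<close> takes over.\<close>

lemma walk_append: "walk h u \<Longrightarrow> walk (h + k) (u @ v) \<longleftrightarrow> walk k v"
  by (induction h u rule: walk.induct) auto

lemma walk_replicate_U: "walk h (replicate k U @ w) \<longleftrightarrow> walk (h + k) w"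
  by (induction k arbitrary: h) auto

lemma walk_parity: "walk h w \<Longrightarrow> even (length w + h)"
  by (induction h w rule: walk.induct) auto

text \<open>The displayed \<open>D\<close> is the first step below the starting height. The
  induction is on length because an initial \<open>U\<close> requires two splits, the second one
  applied to the remainder of the first.\<close>

lemma walk_first_descent:
  "walk (Suc h) w \<Longrightarrow> \<exists>u v. w = u @ D # v \<and> walk 0 u \<and> walk h v"
proof (induction w arbitrary: h rule: length_induct)
  case (1 w)
  show ?case
  proof (cases w)
    case Nil
    with 1 show ?thesis by simp
  next
    case (Cons a w')
    show ?thesis
    proof (cases a)
      case D
      with 1 Cons have "w = [] @ D # w' \<and> walk 0 [] \<and> walk h w'" by simp
      then show ?thesis by blast
    next
      case U
      with 1 Cons have "walk (Suc (Suc h)) w'" by simp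
      then obtain u1 v1 where 1: "w' = u1 @ D # v1" "walk 0 u1" "walk (Suc h) v1"
        using "1.IH" Cons by (metis length_Cons lessI)
      then have "length v1 < length w" using Cons by simp
      then obtain u2 v2 where 2: "v1 = u2 @ D # v2" "walk 0 u2" "walk h v2"
        using "1.IH" 1 by blast
      \<comment> \<open>The first descent only undoes the initial \<open>U\<close>; the part up to
        the second descent, with that \<open>U\<close> in front, is the required Dyck path.\<close>
      have "walk 1 (u1 @ D # u2)" using walk_append[OF 1(2), of 1] 2 by simp
      with 1 2 Cons U have "w = (U # u1 @ D # u2) @ D # v2 \<and> walk 0 (U # u1 @ D # u2) \<and> walk h v2"
        by simp
      then show ?thesis by blast
    qed
  qed
qed

lemma walk_Suc_iff: "walk (Suc h) w \<longleftrightarrow> (\<exists>u v. w = u @ D # v \<and> walk 0 u \<and> walk h v)"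
proof
  assume "\<exists>u v. w = u @ D # v \<and> walk 0 u \<and> walk h v"
  then show "walk (Suc h) w" using walk_append[of 0 _ "Suc h"] by auto
qed (rule walk_first_descent)

text \<open>If one prefix extended the other by \<open>t\<close>, then \<open>t\<close> would itself
  be a Dyck path; were it nonempty, it would start with \<open>U\<close>, whereas the remainder
  starts with \<open>D\<close>. This is the source of unambiguity.\<close>

lemma walk_prefix_unique:
  assumes "walk 0 u" "walk 0 u'" "u @ v = u' @ v'"
    and "v = [] \<or> hd v = D" "v' = [] \<or> hd v' = D"
  shows "u = u'"
proof -
  have *: "t = []" if "walk 0 x" "walk 0 (x @ t)" "t @ y = [] \<or> hd (t @ y) = D" for x t y
  proof -
    have "walk 0 t" using walk_append[OF that(1), of 0 t] that(2) by simp
    with that(3) show ?thesis by (cases t) auto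
  qed
  from assms(3) obtain t where "u = u' @ t \<and> t @ v = v' \<or> u @ t = u' \<and> v = t @ v'"
    by (auto simp: append_eq_append_conv2)
  then show ?thesis
    using assms *[of u' t v] *[of u t v'] by auto
qed

section \<open>Up-runs\<close>

text \<open>A run cannot contain the separating \<open>D\<close>, and as a boundary of a run this
  \<open>D\<close> acts just like the end of a word.\<close>

lemma has_up_run_append_D:
  "has_up_run (u @ D # v) l \<longleftrightarrow> has_up_run u l \<or> has_up_run v l"
proof
  assume "has_up_run (u @ D # v) l"
  then obtain xs ys where l: "0 < l" and eq: "u @ D # v = xs @ replicate l U @ ys"
    and xs: "xs = [] \<or> last xs \<noteq> U" and ys: "ys = [] \<or> hd ys \<noteq> U"
    by (auto simp: has_up_run_def)
  from eq consider
      (right) t where "xs = u @ t" "t @ replicate l U @ ys = D # v"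
    | (left) t where "u = xs @ t" "replicate l U @ ys = t @ D # v"
    unfolding append_eq_append_conv2[of u] by metis
  then show "has_up_run u l \<or> has_up_run v l"
  proof cases
    case right
    from l right(2) obtain t' where t': "t = D # t'" "v = t' @ replicate l U @ ys"
      by (cases t; cases l) auto
    with right(1) xs have "t' = [] \<or> last t' \<noteq> U" by auto
    with l t' ys show ?thesis unfolding has_up_run_def by blast
  next
    case left
    from left(2) obtain t' where
      "replicate l U = t @ t' \<and> t' @ ys = D # v \<or> replicate l U @ t' = t \<and> ys = t' @ D # v"
      by (auto simp: append_eq_append_conv2)
    \<comment> \<open>A run starting in \<open>u\<close> and reaching past it would contain the
      separating \<open>D\<close>.\<close>
    moreover have "t' = []" if "replicate l U = t @ t'" "t' @ ys = D # v"
    proof (rule ccontr)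
      assume "t' \<noteq> []"
      with that(2) have "D \<in> set t'" by (cases t') auto
      with that(1) have "D \<in> set (replicate l U)" by simp
      then show False by simp
    qed
    ultimately obtain s where "t = replicate l U @ s" "ys = s @ D # v" by auto
    with left(1) ys have "u = xs @ replicate l U @ s" "s = [] \<or> hd s \<noteq> U"
      by (cases s; auto)+
    with l xs show ?thesis unfolding has_up_run_def by blast
  qed
next
  assume "has_up_run u l \<or> has_up_run v l"
  then show "has_up_run (u @ D # v) l"
  proof
    assume "has_up_run u l"
    then obtain xs ys where "0 < l" "u = xs @ replicate l U @ ys"
      "xs = [] \<or> last xs \<noteq> U" "ys = [] \<or> hd ys \<noteq> U"
      by (auto simp: has_up_run_def)
    then have "0 < l" "u @ D # v = xs @ replicate l U @ (ys @ D # v)"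
      "xs = [] \<or> last xs \<noteq> U" "hd (ys @ D # v) \<noteq> U"
      by (cases ys; auto)+
    then show ?thesis unfolding has_up_run_def by blast
  next
    assume "has_up_run v l"
    then obtain xs ys where "0 < l" "v = xs @ replicate l U @ ys"
      "xs = [] \<or> last xs \<noteq> U" "ys = [] \<or> hd ys \<noteq> U"
      by (auto simp: has_up_run_def)
    then have "0 < l" "u @ D # v = (u @ D # xs) @ replicate l U @ ys"
      "last (u @ D # xs) \<noteq> U" "ys = [] \<or> hd ys \<noteq> U"
      by auto
    then show ?thesis unfolding has_up_run_def by blast
  qed
qed

lemma has_up_run_replicate: "has_up_run (replicate k U) l \<longleftrightarrow> l = k \<and> 0 < k"
proof
  assume "has_up_run (replicate k U) l"
  then obtain xs ys where l: "0 < l" and eq: "replicate k U = xs @ replicate l U @ ys"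
    and xs: "xs = [] \<or> last xs \<noteq> U" and ys: "ys = [] \<or> hd ys \<noteq> U"
    by (auto simp: has_up_run_def)
  have "set (xs @ ys) \<subseteq> set (replicate k U)" unfolding eq by auto
  then have "set xs \<subseteq> {U}" "set ys \<subseteq> {U}" by (auto split: if_splits)
  with xs ys have "xs = []" "ys = []"
    using last_in_set[of xs] hd_in_set[of ys] by blast+
  with eq l show "l = k \<and> 0 < k" by (metis append_Nil append_Nil2 length_replicate)
next
  assume "l = k \<and> 0 < k"
  then show "has_up_run (replicate k U) l"
    unfolding has_up_run_def by (metis append_Nil append_Nil2)
qed

lemma up_runs_avoid_append_D:
  "up_runs_avoid (u @ D # v) S \<longleftrightarrow> up_runs_avoid u S \<and> up_runs_avoid v S"
  by (auto simp: up_runs_avoid_def has_up_run_append_D)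

lemma up_runs_avoid_replicate: "up_runs_avoid (replicate k U) S \<longleftrightarrow> k \<notin> S \<or> k = 0"
  by (auto simp: up_runs_avoid_def has_up_run_replicate)

lemma up_runs_avoid_Nil: "up_runs_avoid [] S"
  using up_runs_avoid_replicate[of 0] by simp

section \<open>Decomposition by the initial up-run\<close>

text \<open>The forbidden set is arbitrary: the decomposition needs only
  \<open>0 \<notin> S\<close>, and the arithmetic progression enters only at the very end.\<close>

definition avoiding :: "nat set \<Rightarrow> letter list set" where
  "avoiding S = {w. dyck_path w \<and> up_runs_avoid w S}"

text \<open>For \<open>L = avoiding S\<close> and \<open>k \<notin> S\<close> these are the members
  of \<open>L\<close> whose initial up-run has length \<open>k\<close>, where \<open>k = 0\<close>
  stands for the empty path. A positive \<open>k \<in> S\<close>, such as \<open>B\<close>, gives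
  words outside \<open>L\<close>.\<close>

definition initial_run :: "letter list set \<Rightarrow> nat \<Rightarrow> letter list set" where
  "initial_run L k = {[U]} \<up> k \<odot> ({[D]} \<odot> L) \<up> k"

text \<open>Cutting at the first descent below each of the heights \<open>h, ..., 1\<close> leaves
  Dyck paths, and cutting at a \<open>D\<close> respects the avoidance condition.\<close>

lemma walks_avoiding:
  "{w. walk h w \<and> up_runs_avoid w S} = avoiding S \<odot> ({[D]} \<odot> avoiding S) \<up> h"
proof (induction h)
  case 0
  then show ?case by (simp add: avoiding_def dyck_path_iff_walk)
next
  case (Suc h)
  have "{w. walk (Suc h) w \<and> up_runs_avoid w S} =
      avoiding S \<odot> {[D]} \<odot> {w. walk h w \<and> up_runs_avoid w S}"
    by (auto simp: walk_Suc_iff up_runs_avoid_append_D avoiding_def dyck_path_iff_walk conc_def)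
      blast
  also have "\<dots> = avoiding S \<odot> ({[D]} \<odot> avoiding S) \<up> Suc h"
    by (simp add: Suc.IH conc_assoc)
  finally show ?case .
qed

lemma initial_run_0 [simp]: "initial_run L 0 = {[]}"
  by (simp add: initial_run_def)

text \<open>Exposing the first \<open>D\<close> separates the initial run from the rest
  \<open>v\<close>, which then starts one level lower, at height \<open>k\<close>.\<close>

lemma initial_run_Suc:
  "initial_run (avoiding S) (Suc k) =
    (\<lambda>v. replicate (Suc k) U @ D # v) ` {w. walk k w \<and> up_runs_avoid w S}"
proof -
  have "initial_run (avoiding S) (Suc k) =
      {[U]} \<up> Suc k \<odot> {[D]} \<odot> {w. walk k w \<and> up_runs_avoid w S}"
    unfolding initial_run_def walks_avoiding
    by (simp only: lang_pow.simps conc_assoc)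
  then show ?thesis unfolding lang_pow_singleton by (auto simp: conc_def)
qed

lemma avoiding_eq_UN_initial_run:
  assumes "0 \<notin> S"
  shows "avoiding S = (\<Union>k \<in> - S. initial_run (avoiding S) k)"
proof (intro equalityI subsetI)
  fix w assume "w \<in> avoiding S"
  then have walk: "walk 0 w" and avoid: "up_runs_avoid w S"
    by (auto simp: avoiding_def dyck_path_iff_walk)
  define k where "k = length (takeWhile (\<lambda>a. a = U) w)"
  have run: "takeWhile (\<lambda>a. a = U) w = replicate k U"
    unfolding k_def by (metis (mono_tags) replicate_eqI set_takeWhileD)
  show "w \<in> (\<Union>k \<in> - S. initial_run (avoiding S) k)"
  proof (cases "dropWhile (\<lambda>a. a = U) w")
    case Nil
    then have "w = replicate k U @ []" using run takeWhile_dropWhile_id by metis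
    \<comment> \<open>A positive number of \<open>U\<close>s alone cannot end at height 0; the empty
      path is then supplied by the index 0, which is where \<open>0 \<notin> S\<close> is
      used.\<close>
    with walk have "w = []" by (simp only: walk_replicate_U) auto
    with assms show ?thesis by force
  next
    case (Cons a v)
    have "a \<noteq> U" using hd_dropWhile[of "\<lambda>a. a = U" w] Cons by auto
    then have "a = D" by (cases a) auto
    with run Cons have w: "w = replicate k U @ D # v" by (metis takeWhile_dropWhile_id)
    from walk have "walk k (D # v)" unfolding w walk_replicate_U by simp
    then obtain j where j: "k = Suc j" "walk j v" by (cases k) auto
    from avoid have "k \<notin> S" "up_runs_avoid v S"
      using j(1) unfolding w up_runs_avoid_append_D up_runs_avoid_replicate by auto
    with j w have "w \<in> initial_run (avoiding S) k" by (auto simp: initial_run_Suc)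
    with \<open>k \<notin> S\<close> show ?thesis by blast
  qed
next
  fix w assume "w \<in> (\<Union>k \<in> - S. initial_run (avoiding S) k)"
  then obtain k where k: "k \<notin> S" "w \<in> initial_run (avoiding S) k" by auto
  show "w \<in> avoiding S"
  proof (cases k)
    case 0
    with k show ?thesis by (simp add: avoiding_def dyck_path_iff_walk up_runs_avoid_Nil)
  next
    case (Suc j)
    with k obtain v where v: "w = replicate k U @ D # v" "walk j v" "up_runs_avoid v S"
      by (auto simp: initial_run_Suc)
    with Suc have "walk 0 w" unfolding v(1) walk_replicate_U by simp
    with v k show ?thesis
      by (simp add: avoiding_def dyck_path_iff_walk up_runs_avoid_append_D up_runs_avoid_replicate)
  qed
qed

section \<open>Disjointness for different initial run lengths\<close>

lemma lang_pow_D_hd: "v \<in> ({[D]} \<odot> L) \<up> k \<Longrightarrow> v = [] \<or> hd v = D"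
  by (cases k) (auto simp: conc_def)

text \<open>The factor after the block of \<open>U\<close>s is empty or starts with
  \<open>D\<close>, so the word determines \<open>k\<close>.\<close>

lemma takeWhile_initial_run:
  assumes "w \<in> initial_run L k"
  shows "takeWhile (\<lambda>a. a = U) w = replicate k U"
proof -
  from assms obtain v where "w = replicate k U @ v" "v \<in> ({[D]} \<odot> L) \<up> k"
    unfolding initial_run_def lang_pow_singleton by (auto elim: concE)
  with lang_pow_D_hd[of v L k] show ?thesis by (cases v) (auto simp: takeWhile_append)
qed

lemma initial_run_disjoint:
  assumes "j \<noteq> k"
  shows "initial_run L j \<inter> initial_run L k = {}"
  using assms takeWhile_initial_run by (metis disjoint_iff length_replicate)

lemma UN_initial_run_disjoint:
  assumes "I \<inter> J = {}"
  shows "(\<Union>k\<in>I. initial_run L k) \<inter> (\<Union>k\<in>J. initial_run L k) = {}"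
proof (rule equals0I)
  fix w assume "w \<in> (\<Union>k\<in>I. initial_run L k) \<inter> (\<Union>k\<in>J. initial_run L k)"
  then obtain j k where "j \<in> I" "k \<in> J" "w \<in> initial_run L j \<inter> initial_run L k" by blast
  moreover from this have "j \<noteq> k" using assms by blast
  ultimately show False using initial_run_disjoint by blast
qed

section \<open>Enumeration\<close>

unbundle fps_syntax

text \<open>Factors such as \<open>{[D]}\<close> contain words of odd length, so products are
  counted by length first and converted to semilength afterwards.\<close>

definition length_enumerator :: "letter list set \<Rightarrow> int fps" where
  "length_enumerator L = Abs_fps (\<lambda>n. int (card {w \<in> L. length w = n}))"

lemma length_enumerator_nth: "length_enumerator L $ n = int (card {w \<in> L. length w = n})"
  by (simp add: length_enumerator_def)

lemma weight_enumerator_nth: "weight_enumerator L $ n = int (card {w \<in> L. length w = 2 * n})"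
  by (simp add: weight_enumerator_def)

lemma finite_words_length: "finite {w \<in> L. length w = n}" for L :: "letter list set"
proof -
  have "(UNIV :: letter set) = {U, D}" using letter.exhaust by auto
  then have "finite (UNIV :: letter set)" by (metis finite.emptyI finite_insert)
  then have "finite {w :: letter list. length w = n}"
    using finite_lists_length_eq[of "UNIV :: letter set" n] by simp
  then show ?thesis by (rule rev_finite_subset) auto
qed

lemma length_enumerator_singleton: "length_enumerator {w} = fps_X ^ length w"
proof (rule fps_ext)
  fix n
  have "{v \<in> {w}. length v = n} = (if n = length w then {w} else {})" by auto
  then show "length_enumerator {w} $ n = (fps_X ^ length w) $ n"
    by (simp add: length_enumerator_nth)
qed

text \<open>Injectivity of concatenation means that the product is unambiguous; counting by the
  length of the left factor then gives the Cauchy product.\<close>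

lemma length_enumerator_conc:
  assumes "inj_on (\<lambda>(u, v). u @ v) (L \<times> L')"
  shows "length_enumerator (L \<odot> L') = length_enumerator L * length_enumerator L'"
proof (rule fps_ext)
  fix n
  define F where "F i = {u \<in> L. length u = i} \<times> {v \<in> L'. length v = n - i}" for i
  have words: "{w \<in> L \<odot> L'. length w = n} = (\<lambda>(u, v). u @ v) ` (\<Union>i\<in>{0..n}. F i)"
    unfolding conc_image F_def by force
  have "(\<Union>i\<in>{0..n}. F i) \<subseteq> L \<times> L'" by (auto simp: F_def)
  then have "card {w \<in> L \<odot> L'. length w = n} = card (\<Union>i\<in>{0..n}. F i)"
    unfolding words by (intro card_image inj_on_subset[OF assms])
  also have "\<dots> = (\<Sum>i=0..n. card (F i))"
  proof (rule card_UN_disjoint)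
    show "\<forall>i\<in>{0..n}. finite (F i)"
      unfolding F_def by (intro ballI finite_cartesian_product finite_words_length)
  qed (auto simp: F_def)
  also have "\<dots> = (\<Sum>i=0..n. card {u \<in> L. length u = i} * card {v \<in> L'. length v = n - i})"
    by (simp add: F_def card_cartesian_product)
  finally show "length_enumerator (L \<odot> L') $ n = (length_enumerator L * length_enumerator L') $ n"
    by (simp add: length_enumerator_nth fps_mult_nth)
qed

lemma length_enumerator_conc_singleton:
  "length_enumerator ({w} \<odot> L) = fps_X ^ length w * length_enumerator L"
proof -
  have "inj_on (\<lambda>(u, v). u @ v) ({w} \<times> L)" by (auto simp: inj_on_def)
  then show ?thesis by (simp add: length_enumerator_conc length_enumerator_singleton)
qed

lemma weight_enumerator_Un:
  assumes "L \<inter> L' = {}"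
  shows "weight_enumerator (L \<union> L') = weight_enumerator L + weight_enumerator L'"
proof (rule fps_ext)
  fix n
  have "{w \<in> L \<union> L'. length w = 2 * n} = {w \<in> L. length w = 2 * n} \<union> {w \<in> L'. length w = 2 * n}"
    by auto
  moreover have "{w \<in> L. length w = 2 * n} \<inter> {w \<in> L'. length w = 2 * n} = {}" using assms by auto
  ultimately show "weight_enumerator (L \<union> L') $ n = (weight_enumerator L + weight_enumerator L') $ n"
    by (simp add: weight_enumerator_nth card_Un_disjoint finite_words_length)
qed

lemma weight_enumerator_UN:
  assumes "finite I" and "\<And>i j. i \<in> I \<Longrightarrow> j \<in> I \<Longrightarrow> i \<noteq> j \<Longrightarrow> L i \<inter> L j = {}"
  shows "weight_enumerator (\<Union>i\<in>I. L i) = (\<Sum>i\<in>I. weight_enumerator (L i))"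
  using assms
proof (induction I)
  case empty
  show ?case by (rule fps_ext) (simp add: weight_enumerator_nth)
next
  case (insert i I)
  have "L i \<inter> (\<Union>j\<in>I. L j) = {}" using insert by blast
  with insert show ?case by (simp add: weight_enumerator_Un)
qed

section \<open>From length to semilength\<close>

lemma fps_compose_X2_nth:
  fixes f :: "'a::comm_ring_1 fps"
  shows "(f oo fps_X ^ 2) $ n = (if even n then f $ (n div 2) else 0)"
proof -
  have "(f oo fps_X ^ 2) $ n = (\<Sum>i=0..n. if 2 * i = n then f $ i else 0)"
    by (auto simp: fps_compose_nth simp flip: power_mult intro!: sum.cong)
  also have "\<dots> = (if even n then f $ (n div 2) else 0)"
  proof (cases "even n")
    case True
    then have "(\<Sum>i=0..n. if 2 * i = n then f $ i else 0) =
        (\<Sum>i=0..n. if i = n div 2 then f $ i else 0)"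
      by (intro sum.cong) auto
    with True show ?thesis by simp
  qed (auto intro!: sum.neutral)
  finally show ?thesis .
qed

lemma length_enumerator_even:
  assumes "\<And>w. w \<in> L \<Longrightarrow> even (length w)"
  shows "length_enumerator L = weight_enumerator L oo fps_X ^ 2"
proof (rule fps_ext)
  fix n
  show "length_enumerator L $ n = (weight_enumerator L oo fps_X ^ 2) $ n"
  proof (cases "even n")
    case True
    then show ?thesis
      by (simp add: length_enumerator_nth weight_enumerator_nth fps_compose_X2_nth)
  next
    case False
    with assms have "{w \<in> L. length w = n} = {}" by auto
    then have "card {w \<in> L. length w = n} = 0" by (simp only: card.empty)
    with False show ?thesis
      by (simp add: length_enumerator_nth fps_compose_X2_nth)
  qed
qed

text \<open>Reading off the coefficients of even index undoes the substitution of
  \<open>fps_X ^ 2\<close>.\<close>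

lemma weight_enumerator_eqI:
  assumes "length_enumerator L = f oo fps_X ^ 2"
  shows "weight_enumerator L = f"
proof (rule fps_ext)
  fix n
  have "weight_enumerator L $ n = length_enumerator L $ (2 * n)"
    by (simp add: length_enumerator_nth weight_enumerator_nth)
  then show "weight_enumerator L $ n = f $ n"
    by (simp add: assms fps_compose_X2_nth)
qed

text \<open>The left factor is a Dyck path and the right one is empty or starts with
  \<open>D\<close>, so \<open>walk_prefix_unique\<close> makes the product unambiguous.\<close>

lemma length_enumerator_dyck_conc:
  assumes "\<And>u. u \<in> L \<Longrightarrow> dyck_path u"
  shows "length_enumerator (L \<odot> ({[D]} \<odot> L') \<up> k) =
    length_enumerator L * length_enumerator (({[D]} \<odot> L') \<up> k)"
proof (rule length_enumerator_conc, rule inj_onI, clarify)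
  fix u v u' v'
  assume "u \<in> L" "u' \<in> L" "v \<in> ({[D]} \<odot> L') \<up> k" "v' \<in> ({[D]} \<odot> L') \<up> k" "u @ v = u' @ v'"
  moreover from this have "u = u'"
    using assms by (intro walk_prefix_unique[of u u' v v'] lang_pow_D_hd)
      (auto simp flip: dyck_path_iff_walk)
  ultimately show "u = u' \<and> v = v'" by simp
qed

lemma length_enumerator_D_pow:
  assumes "\<And>u. u \<in> L \<Longrightarrow> dyck_path u"
  shows "length_enumerator (({[D]} \<odot> L) \<up> k) = (fps_X * length_enumerator L) ^ k"
proof (induction k)
  case 0
  show ?case by (simp add: length_enumerator_singleton)
next
  case (Suc k)
  then show ?case
    by (simp add: conc_assoc length_enumerator_conc_singleton length_enumerator_dyck_conc assms)
qed

lemma weight_enumerator_U_pow_conc: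
  assumes "\<And>u. u \<in> L \<Longrightarrow> dyck_path u"
  shows weight_enumerator_initial_run:
      "weight_enumerator (initial_run L k) = fps_X ^ k * weight_enumerator L ^ k"
    and weight_enumerator_U_pow_dyck_conc:
      "weight_enumerator ({[U]} \<up> k \<odot> L \<odot> ({[D]} \<odot> L) \<up> k) =
        fps_X ^ k * weight_enumerator L ^ (k + 1)"
proof -
  have even: "even (length w)" if "w \<in> L" for w
    using walk_parity[of 0 w] assms[OF that] by (simp add: dyck_path_iff_walk)
  \<comment> \<open>Under the substitution \<open>fps_X ^ k\<close> becomes
    \<open>fps_X ^ (2 * k)\<close>, written as two factors: one for the \<open>k\<close> letters
    \<open>U\<close>, one for the \<open>k\<close> letters \<open>D\<close>.\<close>
  have compose: "(fps_X ^ k * f ^ m) oo fps_X ^ 2 =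
      fps_X ^ k * (fps_X * (1 :: int fps)) ^ k * (f oo fps_X ^ 2) ^ m" for f m
    by (simp add: fps_compose_mult_distrib fps_compose_power[symmetric] power2_eq_square
        power_mult_distrib)
  show "weight_enumerator (initial_run L k) = fps_X ^ k * weight_enumerator L ^ k"
    unfolding initial_run_def lang_pow_singleton
    by (rule weight_enumerator_eqI)
      (simp add: length_enumerator_conc_singleton length_enumerator_D_pow assms
        length_enumerator_even[OF even] compose power_mult_distrib mult_ac)
  show "weight_enumerator ({[U]} \<up> k \<odot> L \<odot> ({[D]} \<odot> L) \<up> k) =
      fps_X ^ k * weight_enumerator L ^ (k + 1)"
    unfolding lang_pow_singleton
    by (rule weight_enumerator_eqI, unfold compose)
      (simp add: length_enumerator_conc_singleton length_enumerator_dyck_conc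
        length_enumerator_D_pow assms length_enumerator_even[OF even] power_mult_distrib mult_ac)
qed

section \<open>The grammatical equation and its enumeration\<close>

lemma U_pow_avoiding_eq_UN_initial_run:
  assumes "0 \<notin> S"
  shows "{[U]} \<up> A \<odot> avoiding S \<odot> ({[D]} \<odot> avoiding S) \<up> A =
    (\<Union>k \<in> (+) A ` (- S). initial_run (avoiding S) k)"
proof -
  let ?P = "avoiding S"
  have "{[U]} \<up> A \<odot> ?P \<odot> ({[D]} \<odot> ?P) \<up> A =
      {[U]} \<up> A \<odot> (\<Union>k \<in> - S. initial_run ?P k) \<odot> ({[D]} \<odot> ?P) \<up> A"
    using avoiding_eq_UN_initial_run[OF assms] by simp
  also have "\<dots> = (\<Union>k \<in> - S. {[U]} \<up> A \<odot> initial_run ?P k \<odot> ({[D]} \<odot> ?P) \<up> A)"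
    by (simp only: conc_UN_left conc_UN_right)
  \<comment> \<open>The blocks of \<open>U\<close>s merge, and so do the powers of
    \<open>{[D]} \<odot> ?P\<close>: an initial run of length \<open>k\<close> becomes one of length
    \<open>A + k\<close>.\<close>
  also have "\<dots> = (\<Union>k \<in> - S. initial_run ?P (A + k))"
  proof (intro SUP_cong refl)
    fix k
    \<comment> \<open>The exponents are ordered differently so that splitting them puts
      \<open>{[U]} \<up> k\<close> and \<open>({[D]} \<odot> ?P) \<up> k\<close> side by
      side.\<close>
    have "initial_run ?P (A + k) = {[U]} \<up> (A + k) \<odot> ({[D]} \<odot> ?P) \<up> (k + A)"
      by (simp only: initial_run_def add.commute)
    then show "{[U]} \<up> A \<odot> initial_run ?P k \<odot> ({[D]} \<odot> ?P) \<up> A = initial_run ?P (A + k)"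
      by (simp only: initial_run_def lang_pow_add conc_assoc)
  qed
  finally show ?thesis by simp
qed

theorem proposition8:
  fixes A B :: nat and P :: "letter list set" and p :: "int fps"
  assumes "1 \<le> A" and "A \<le> B"
    and "P = {w. dyck_path w \<and> up_runs_avoid w {A * r + B | r. r \<ge> 0}}"
    and "p = weight_enumerator P"
  shows "(P \<union> {[U]} \<up> B \<odot> ({[D]} \<odot> P) \<up> B =
           (\<Union>k \<in> {0..<A}. {[U]} \<up> k \<odot> ({[D]} \<odot> P) \<up> k)
             \<union> {[U]} \<up> A \<odot> (P \<odot> {[D]}) \<up> A \<odot> P) \<and>
         p + fps_X ^ B * p ^ B =
           (\<Sum>k \<in> {0..<A}. fps_X ^ k * p ^ k) + fps_X ^ A * p ^ (A + 1)"
proof -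
  define S where "S = {A * r + B | r. r \<ge> 0}"
  have P: "P = avoiding S" by (simp add: assms(3) avoiding_def S_def)
  have dyck: "dyck_path w" if "w \<in> P" for w using that by (simp add: P avoiding_def)
  have S0: "0 \<notin> S" and BS: "B \<in> S" using assms(1,2) by (auto simp: S_def)
  have shift: "k \<in> insert B (- S) \<longleftrightarrow> k \<in> {0..<A} \<union> (+) A ` (- S)" for k
  proof -
    have "k \<in> S \<and> k \<noteq> B \<longleftrightarrow> A \<le> k \<and> k - A \<in> S"
    proof
      assume k: "k \<in> S \<and> k \<noteq> B"
      then obtain r where r: "k = A * r + B" by (auto simp: S_def)
      \<comment> \<open>\<open>k \<noteq> B\<close> rules out \<open>r = 0\<close>, so
        \<open>A\<close> can be subtracted once.\<close>
      with k obtain q where "r = Suc q" by (cases r) auto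
      with r show "A \<le> k \<and> k - A \<in> S" by (auto simp: S_def)
    next
      assume k: "A \<le> k \<and> k - A \<in> S"
      then obtain r where "k - A = A * r + B" by (auto simp: S_def)
      moreover have "k = A + (k - A)" using k by simp
      ultimately have k_eq: "k = A * Suc r + B" by simp
      then have "k \<in> S" unfolding S_def by blast
      \<comment> \<open>\<open>A\<close> is positive, so \<open>k\<close> exceeds
        \<open>B\<close>.\<close>
      with k_eq assms(1) show "k \<in> S \<and> k \<noteq> B" by simp
    qed
    moreover have "k \<in> (+) A ` (- S) \<longleftrightarrow> A \<le> k \<and> k - A \<notin> S"
      by (auto simp: image_iff intro!: bexI[of _ "k - A"])
    ultimately show ?thesis by auto
  qed
  have tail: "{[U]} \<up> A \<odot> (P \<odot> {[D]}) \<up> A \<odot> P = {[U]} \<up> A \<odot> P \<odot> ({[D]} \<odot> P) \<up> A"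
    by (simp only: lang_pow_rotate)
  have tail_UN: "{[U]} \<up> A \<odot> P \<odot> ({[D]} \<odot> P) \<up> A = (\<Union>k \<in> (+) A ` (- S). initial_run P k)"
    unfolding P by (rule U_pow_avoiding_eq_UN_initial_run[OF S0])
  have P_UN: "P = (\<Union>k \<in> - S. initial_run P k)"
    unfolding P by (rule avoiding_eq_UN_initial_run[OF S0])
  have "P \<union> initial_run P B = (\<Union>k \<in> insert B (- S). initial_run P k)"
    using P_UN by auto
  also have "insert B (- S) = {0..<A} \<union> (+) A ` (- S)" using shift by blast
  finally have grammar: "P \<union> initial_run P B =
      (\<Union>k \<in> {0..<A}. initial_run P k) \<union> {[U]} \<up> A \<odot> P \<odot> ({[D]} \<odot> P) \<up> A"
    unfolding tail_UN by (simp only: UN_Un)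
  \<comment> \<open>\<open>B\<close> is a forbidden length, so the union on the left of the
    grammatical equation is disjoint and the weights add.\<close>
  have "P \<inter> initial_run P B = {}"
    using UN_initial_run_disjoint[of "- S" "{B}" P] BS P_UN by auto
  then have "p + fps_X ^ B * p ^ B = weight_enumerator (P \<union> initial_run P B)"
    by (simp add: assms(4) weight_enumerator_Un weight_enumerator_initial_run dyck)
  also have "\<dots> = weight_enumerator (\<Union>k \<in> {0..<A}. initial_run P k) +
      weight_enumerator ({[U]} \<up> A \<odot> P \<odot> ({[D]} \<odot> P) \<up> A)"
    unfolding grammar
  proof (rule weight_enumerator_Un)
    \<comment> \<open>The initial run lengths are below \<open>A\<close> on one side and at least
      \<open>A\<close> on the other.\<close>
    show "(\<Union>k \<in> {0..<A}. initial_run P k) \<inter> ({[U]} \<up> A \<odot> P \<odot> ({[D]} \<odot> P) \<up> A) = {}"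
      unfolding tail_UN by (rule UN_initial_run_disjoint) auto
  qed
  also have "weight_enumerator (\<Union>k \<in> {0..<A}. initial_run P k) =
      (\<Sum>k \<in> {0..<A}. fps_X ^ k * p ^ k)"
    by (simp add: weight_enumerator_UN initial_run_disjoint weight_enumerator_initial_run dyck assms(4))
  also have "weight_enumerator ({[U]} \<up> A \<odot> P \<odot> ({[D]} \<odot> P) \<up> A) = fps_X ^ A * p ^ (A + 1)"
    unfolding assms(4) by (rule weight_enumerator_U_pow_dyck_conc[OF dyck])
  finally show ?thesis
    using grammar unfolding tail initial_run_def by blast
qed

end
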